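(* Let $(\mathcal{X}_\alpha)_{\alpha\in\mathfrak{A}}$ be a family in $\Lambda$ consisting of independent $\sigma$-fields, and let $\mathcal{Z}\in\Lambda$. Then $$(\lor_{\alpha\in\mathfrak{A}}\mathcal{X}_\alpha)\land\mathcal{Z}=\lor_{\alpha\in\mathfrak{A}}(\mathcal{X}_\alpha\land\mathcal{Z}),$$ provided that (i) the $\mathcal{X}_\alpha$, $\alpha\in\mathfrak{A}$, are conditionally independent given $\mathcal{Z}$, and (ii) $\mathbb{P}[X_\alpha\vert\mathcal{Z}]$ is $\mathcal{X}_\alpha$-measurable for all $X_\alpha\in\mathcal{X}_\alpha$ and all $\alpha\in\mathfrak{A}$.
   Context: $(\Omega,\mathcal{M},\mathbb{P})$ is a probability space ($\mathbb{P}$ itself need not be complete). $0_\Lambda:=\mathbb{P}^{-1}(\{0,1\})$ is the collection of all events of $\mathcal{M}$ having probability $0$ or $1$. A sub-$\sigma$-field of $\mathcal{M}$ is called complete if it contains $0_\Lambda$, and $\Lambda$ denotes the collection of all complete sub-$\sigma$-fields of $\mathcal{M}$. For $\mathcal{X},\mathcal{Y}\in\Lambda$, $\mathcal{X}\land\mathcal{Y}:=\mathcal{X}\cap\mathcal{Y}$. For a family $(\mathcal{X}_t)_{t\in T}$ in $\Lambda$, $\lor_{t\in T}\mathcal{X}_t$ is the smallest complete sub-$\sigma$-field of $\mathcal{M}$ containing $\cup_{t\in T}\mathcal{X}_t$ (equal to $0_\Lambda$ when $T=\emptyset$). Index sets are arbitrary. (Conditional) independence of a family of $\sigma$-fields means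 mutual (conditional) independence, under $\mathbb{P}$, of every finite subfamily. $\mathbb{P}[F\vert\mathcal{Z}]$ denotes the conditional probability of $F\in\mathcal{M}$ given $\mathcal{Z}$ (versions are a.s. equal; as all $\sigma$-fields are complete, measurability does not depend on the chosen version). *)

theory Defs
  imports "HOL-Probability.Probability"
begin

text \<open>
  Sub-\<open>\<sigma>\<close>-fields are represented as sets of events (type \<open>'a set set\<close>), so that the meet
  of two of them is plain set intersection.
\<close>

definition trivial_events :: "'a measure \<Rightarrow> 'a set set" where
  "trivial_events M = {A \<in> sets M. measure M A \<in> {0, 1}}"

definition complete_subfields :: "'a measure \<Rightarrow> 'a set set set" where
  "complete_subfields M =
     {Y. sigma_algebra (space M) Y \<and> Y \<subseteq> sets M \<and> trivial_events M \<subseteq> Y}"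

definition join_subfields :: "'a measure \<Rightarrow> 'i set \<Rightarrow> ('i \<Rightarrow> 'a set set) \<Rightarrow> 'a set set" where
  "join_subfields M T X = \<Inter> {Y \<in> complete_subfields M. (\<Union>t\<in>T. X t) \<subseteq> Y}"

text \<open>
  The library's conditional expectation expects a measure as conditioning argument, of which only
  the space and the measurable sets matter; hence the use of \<^const>\<open>sigma\<close> below.
\<close>

definition cond_prob_given :: "'a measure \<Rightarrow> 'a set set \<Rightarrow> 'a set \<Rightarrow> 'a \<Rightarrow> real" where
  "cond_prob_given M Z F = real_cond_exp M (sigma (space M) Z) (indicator F)"

definition cond_indep_sets ::
    "'a measure \<Rightarrow> 'a set set \<Rightarrow> ('i \<Rightarrow> 'a set set) \<Rightarrow> 'i set \<Rightarrow> bool" where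
  "cond_indep_sets M Z X I \<longleftrightarrow>
     (\<forall>i\<in>I. X i \<subseteq> sets M) \<and>
     (\<forall>J\<subseteq>I. J \<noteq> {} \<longrightarrow> finite J \<longrightarrow>
        (\<forall>A\<in>Pi J X. AE \<omega> in M.
           cond_prob_given M Z (\<Inter>j\<in>J. A j) \<omega> = (\<Prod>j\<in>J. cond_prob_given M Z (A j) \<omega>)))"

lemma sets_sigma_complete_subfield:
  assumes "Y \<in> complete_subfields M"
  shows "sets (sigma (space M) Y) = Y"
  using assms
  by (simp add: complete_subfields_def sigma_algebra.sets_measure_of_eq)

lemma sigma_sets_in_complete_subfields:
  assumes "\<And>t. t \<in> T \<Longrightarrow> X t \<subseteq> sets M"
  shows "sigma_sets (space M) (trivial_events M \<union> (\<Union>t\<in>T. X t)) \<in> complete_subfields M"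
    (is "sigma_sets _ ?G \<in> _")
proof -
  have G: "?G \<subseteq> sets M"
    using assms by (auto simp: trivial_events_def)
  then have "?G \<subseteq> Pow (space M)"
    using sets.space_closed[of M] by blast
  then have "sigma_algebra (space M) (sigma_sets (space M) ?G)"
    by (rule sigma_algebra_sigma_sets)
  moreover have "sigma_sets (space M) ?G \<subseteq> sets M"
    using G by (rule sets.sigma_sets_subset)
  ultimately show ?thesis
    by (auto simp: complete_subfields_def)
qed

lemma join_subfields_eq_sigma_sets:
  assumes "\<And>t. t \<in> T \<Longrightarrow> X t \<subseteq> sets M"
  shows "join_subfields M T X = sigma_sets (space M) (trivial_events M \<union> (\<Union>t\<in>T. X t))"
    (is "_ = ?S")
proof
  have "?S \<in> complete_subfields M"
    using assms by (rule sigma_sets_in_complete_subfields)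
  then show "join_subfields M T X \<subseteq> ?S"
    unfolding join_subfields_def by (intro Inter_lower) auto
  show "?S \<subseteq> join_subfields M T X"
    unfolding join_subfields_def
    by (intro Inter_greatest sigma_algebra.sigma_sets_subset)
       (auto simp: complete_subfields_def)
qed

lemma join_subfields_in_complete_subfields:
  assumes "\<And>t. t \<in> T \<Longrightarrow> X t \<subseteq> sets M"
  shows "join_subfields M T X \<in> complete_subfields M"
  using sigma_sets_in_complete_subfields[of T X M] join_subfields_eq_sigma_sets[of T X M] assms
  by simp

end

theory Submission
  imports Defs
begin

text \<open>
  Let \<open>W\<close> be the join of the \<open>X i \<inter> Z\<close>. On an intersection \<open>G\<close> of finitely many events
  \<open>A j \<in> X j\<close>, conditional independence gives \<open>P[G|Z] = (\<Prod>j. P[A j|Z])\<close>, whose factors are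
  measurable for both \<open>Z\<close> and \<open>X j\<close>; so \<open>P[G|Z]\<close> is \<open>W\<close>-measurable. For \<open>F\<close> in
  the join of the \<open>X i\<close> and in \<open>Z\<close>, the function \<open>h = 1\<^sub>F - P[F|W]\<close> is \<open>Z\<close>-measurable and
  satisfies \<open>E[h|W] = 0\<close>, hence \<open>E[h; G] = E[h P[G|Z]] = 0\<close>. These \<open>G\<close> form a
  \<open>\<pi>\<close>-system generating the join of the \<open>X i\<close>, for which \<open>h\<close> is measurable, so \<open>h = 0\<close> almost
  surely and \<open>F \<in> W\<close> by completeness.
\<close>

section \<open>Vanishing integrals: from a generator to its sigma-algebra\<close>

text \<open>Dynkin's argument: the sets over which \<open>h\<close> integrates to zero are closed
  under countable disjoint unions and, by \<open>total\<close>, under complements. Here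
  \<open>total\<close> is a separate assumption since \<open>E\<close> may lack
  \<open>space M\<close>.\<close>

lemma set_integral_eq_zero_on_sigma_sets:
  fixes h :: "'a \<Rightarrow> real"
  assumes h: "integrable M h"
    and E: "E \<subseteq> sets M" "Int_stable E"
    and total: "(LINT x|M. h x) = 0"
    and zero: "\<And>G. G \<in> E \<Longrightarrow> (LINT x:G|M. h x) = 0"
    and A: "A \<in> sigma_sets (space M) E"
  shows "(LINT x:A|M. h x) = 0"
proof -
  have pow: "E \<subseteq> Pow (space M)"
    using E(1) sets.space_closed by blast
  have sub: "sigma_sets (space M) E \<subseteq> sets M"
    using E(1) by (rule sets.sigma_sets_subset)
  have int: "set_integrable M B h" if "B \<in> sets M" for B
    unfolding set_integrable_def using that h by (rule integrable_mult_indicator)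
  show ?thesis
    using E(2) pow A
  proof (induction rule: sigma_sets_induct_disjoint)
    case (basic A)
    then show ?case by (rule zero)
  next
    case empty
    show ?case by (simp add: set_lebesgue_integral_def)
  next
    case (compl A)
    then have A: "A \<in> sets M" using sub by blast
    have "(LINT x:A \<union> (space M - A)|M. h x) = (LINT x:A|M. h x) + (LINT x:space M - A|M. h x)"
      using A by (intro set_integral_Un int) auto
    moreover have "A \<union> (space M - A) = space M"
      using sets.sets_into_space[OF A] by blast
    ultimately show ?case
      using compl total set_integral_space[OF h] by simp
  next
    case (union A)
    then have "\<And>i. A i \<in> sets M" using sub by blast
    with union show ?case
      by (subst lebesgue_integral_countable_add)
         (auto simp: disjoint_family_on_def intro!: int sets.countable_UN)
  qed
qed

section \<open>Complete sub-sigma-fields and measurability up to null sets\<close>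

lemma complete_subfield_subset_sets:
  assumes "Y \<in> complete_subfields M"
  shows "Y \<subseteq> sets M"
  using assms by (simp add: complete_subfields_def)

lemma subfield_subset_join_subfields:
  assumes "t \<in> T"
  shows "X t \<subseteq> join_subfields M T X"
  using assms by (auto simp: join_subfields_def)

lemma join_subfields_least:
  assumes "Y \<in> complete_subfields M" "\<And>t. t \<in> T \<Longrightarrow> X t \<subseteq> Y"
  shows "join_subfields M T X \<subseteq> Y"
  unfolding join_subfields_def using assms by (intro Inter_lower) auto

lemma finite_measure_subalgebra_complete_subfield:
  assumes "prob_space M" "Y \<in> complete_subfields M"
  shows "finite_measure_subalgebra M (sigma (space M) Y)"
proof -
  interpret prob_space M by fact
  show ?thesis
    using complete_subfield_subset_sets[OF assms(2)]
    by unfold_locales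
       (simp add: subalgebra_def space_measure_of_conv sets_sigma_complete_subfield[OF assms(2)])
qed

lemma measurable_sigma_mono:
  assumes "f \<in> measurable (sigma (space M) Y) N"
    and "Y \<in> complete_subfields M" "W \<in> complete_subfields M" "Y \<subseteq> W"
  shows "f \<in> measurable (sigma (space M) W) N"
  using assms
  by (auto simp: measurable_def space_measure_of_conv sets_sigma_complete_subfield)

text \<open>This is where completeness enters: the functions differ only on a null set, and
  \<open>W\<close> contains every null set of \<open>M\<close>.\<close>

lemma measurable_complete_subfield_cong_AE:
  assumes W: "W \<in> complete_subfields M"
    and f: "f \<in> borel_measurable (sigma (space M) W)"
    and g: "g \<in> borel_measurable M"
    and eq: "AE x in M. f x = (g x :: real)"
  shows "g \<in> borel_measurable (sigma (space M) W)"
proof (rule measurableI)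
  interpret W: sigma_algebra "space M" W
    using W by (simp add: complete_subfields_def)
  fix B :: "real set" assume B: "B \<in> sets borel"
  have "f \<in> borel_measurable M"
    using f complete_subfield_subset_sets[OF W]
    by (auto simp: measurable_def space_measure_of_conv sets_sigma_complete_subfield[OF W])
  with g have N: "{x \<in> space M. f x \<noteq> g x} \<in> sets M" (is "?N \<in> _")
    by measurable
  with eq have N0: "?N \<in> null_sets M"
    by (simp add: AE_iff_null)
  have triv: "C \<in> W" if "C \<in> null_sets M" for C
  proof -
    have "C \<in> trivial_events M"
      using that by (simp add: trivial_events_def measure_eq_0_null_sets null_setsD2)
    with W show ?thesis by (auto simp: complete_subfields_def)
  qed
  have fB: "f -` B \<inter> space M \<in> W"
    using measurable_sets[OF f B] by (simp add: space_measure_of_conv sets_sigma_complete_subfield[OF W])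
  have gB: "g -` B \<inter> space M \<in> sets M"
    using g B by (rule measurable_sets)
  have "?N \<inter> (g -` B \<inter> space M) \<in> null_sets M"
    using N0 gB by (rule null_set_Int2)
  \<comment> \<open>Off \<open>?N\<close> the preimage under \<open>g\<close> is that under
    \<open>f\<close>. The remainder lies in \<open>?N\<close> and is measurable because
    \<open>g\<close> is, so it is itself a null set.\<close>
  then have "(f -` B \<inter> space M - ?N) \<union> (?N \<inter> (g -` B \<inter> space M)) \<in> W"
    using fB triv N0 by (intro W.Un W.Diff) auto
  also have "(f -` B \<inter> space M - ?N) \<union> (?N \<inter> (g -` B \<inter> space M)) = g -` B \<inter> space M"
    by auto
  finally show "g -` B \<inter> space (sigma (space M) W) \<in> sets (sigma (space M) W)"
    by (simp add: space_measure_of_conv sets_sigma_complete_subfield[OF W])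
qed (simp add: space_measure_of_conv)

section \<open>The generating system of finite intersections\<close>

text \<open>The empty \<open>J\<close> is excluded, as in \<open>cond_indep_sets\<close>: its
  intersection would be the whole type rather than \<open>space M\<close>.\<close>

definition finite_meets :: "('i \<Rightarrow> 'a set set) \<Rightarrow> 'i set \<Rightarrow> 'a set set" where
  "finite_meets X I = {\<Inter>j\<in>J. A j | J A. J \<subseteq> I \<and> J \<noteq> {} \<and> finite J \<and> A \<in> Pi J X}"

lemma subset_finite_meets:
  assumes "i \<in> I"
  shows "X i \<subseteq> finite_meets X I"
proof
  fix B assume "B \<in> X i"
  then have "B = (\<Inter>j\<in>{i}. B) \<and> {i} \<subseteq> I \<and> {i} \<noteq> {} \<and> finite {i} \<and> (\<lambda>_. B) \<in> Pi {i} X"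
    using assms by simp
  then show "B \<in> finite_meets X I"
    unfolding finite_meets_def by blast
qed

lemma finite_meets_subset_sets:
  assumes "\<And>i. i \<in> I \<Longrightarrow> X i \<subseteq> sets M"
  shows "finite_meets X I \<subseteq> sets M"
proof
  fix G assume "G \<in> finite_meets X I"
  then obtain J A where J: "G = (\<Inter>j\<in>J. A j)" "J \<subseteq> I" "J \<noteq> {}" "finite J" "A \<in> Pi J X"
    unfolding finite_meets_def by blast
  then have "A j \<in> sets M" if "j \<in> J" for j
    using that assms by blast
  with J show "G \<in> sets M"
    by (auto intro: sets.finite_INT)
qed

text \<open>Two intersections over \<open>J\<close> and \<open>K\<close> are merged over
  \<open>J \<union> K\<close>, with \<open>\<Omega>\<close>, a member of every \<open>X i\<close>,
  as the missing factor.\<close>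

lemma Int_stable_finite_meets:
  assumes alg: "\<And>i. i \<in> I \<Longrightarrow> algebra \<Omega> (X i)"
  shows "Int_stable (finite_meets X I)"
proof (rule Int_stableI)
  fix G H assume "G \<in> finite_meets X I" "H \<in> finite_meets X I"
  then obtain J A K B where J: "G = (\<Inter>j\<in>J. A j)" "J \<subseteq> I" "J \<noteq> {}" "finite J" "A \<in> Pi J X"
    and K: "H = (\<Inter>j\<in>K. B j)" "K \<subseteq> I" "K \<noteq> {}" "finite K" "B \<in> Pi K X"
    unfolding finite_meets_def by blast
  define C where "C i = (if i \<in> J then A i else \<Omega>) \<inter> (if i \<in> K then B i else \<Omega>)" for i
  have into: "D \<subseteq> \<Omega>" if "D \<in> X i" "i \<in> I" for D i
  proof -
    interpret algebra \<Omega> "X i" using that(2) by (rule alg)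
    show ?thesis using that(1) by (rule sets_into_space)
  qed
  have "C \<in> Pi (J \<union> K) X"
  proof
    fix i assume i: "i \<in> J \<union> K"
    then interpret algebra \<Omega> "X i" using J K by (intro alg) auto
    show "C i \<in> X i"
      using J(5) K(5) i unfolding C_def by (auto simp: Pi_iff)
  qed
  moreover have "G \<inter> H = (\<Inter>i\<in>J \<union> K. C i)"
  proof -
    have AJ: "A j \<subseteq> \<Omega>" if "j \<in> J" for j
      using into[of "A j" j] that J by auto
    have BK: "B j \<subseteq> \<Omega>" if "j \<in> K" for j
      using into[of "B j" j] that K by auto
    \<comment> \<open>Since \<open>J\<close> and \<open>K\<close> are nonempty, the factors
      \<open>\<Omega>\<close> cut nothing off.\<close>
    have "G \<subseteq> \<Omega>" "H \<subseteq> \<Omega>"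
      using J(1,3) K(1,3) AJ BK by blast+
    then show ?thesis
      using J(1) K(1) AJ BK unfolding C_def INT_Un by (auto 0 3 split: if_splits)
  qed
  moreover have "J \<union> K \<subseteq> I" "J \<union> K \<noteq> {}" "finite (J \<union> K)"
    using J K by auto
  ultimately show "G \<inter> H \<in> finite_meets X I"
    unfolding finite_meets_def by blast
qed

text \<open>The trivial events enter the generator through any single \<open>X i\<close>. For empty
  \<open>I\<close> the right side would only be \<open>{{}, space M}\<close>.\<close>

lemma join_subfields_eq_sigma_sets_finite_meets:
  assumes X: "\<And>i. i \<in> I \<Longrightarrow> X i \<in> complete_subfields M" and I: "I \<noteq> {}"
  shows "join_subfields M I X = sigma_sets (space M) (finite_meets X I)"
proof
  have "trivial_events M \<union> (\<Union>i\<in>I. X i) \<subseteq> (\<Union>i\<in>I. X i)"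
    using X I by (auto simp: complete_subfields_def)
  also have "\<dots> \<subseteq> finite_meets X I"
    using subset_finite_meets by fast
  finally show "join_subfields M I X \<subseteq> sigma_sets (space M) (finite_meets X I)"
    using X by (subst join_subfields_eq_sigma_sets)
      (auto dest: complete_subfield_subset_sets intro!: sigma_sets_mono')
  have join: "join_subfields M I X \<in> complete_subfields M"
    using X by (intro join_subfields_in_complete_subfields complete_subfield_subset_sets)
  then interpret J: sigma_algebra "space M" "join_subfields M I X"
    by (simp add: complete_subfields_def)
  \<comment> \<open>The earlier lemma is applied to the measure whose measurable sets are the join,
    which yields closure of the join under these intersections.\<close>
  have "finite_meets X I \<subseteq> sets (sigma (space M) (join_subfields M I X))"
    by (rule finite_meets_subset_sets)
       (simp add: sets_sigma_complete_subfield[OF join] subfield_subset_join_subfields)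
  then have "finite_meets X I \<subseteq> join_subfields M I X"
    by (simp add: sets_sigma_complete_subfield[OF join])
  then show "sigma_sets (space M) (finite_meets X I) \<subseteq> join_subfields M I X"
    by (rule J.sigma_sets_subset)
qed

section \<open>Conditional probabilities of finite intersections\<close>

lemma cond_prob_finite_meet_measurable:
  assumes X: "\<And>i. i \<in> I \<Longrightarrow> X i \<in> complete_subfields M"
    and Z: "Z \<in> complete_subfields M"
    and ci: "cond_indep_sets M Z X I"
    and meas: "\<And>i F. i \<in> I \<Longrightarrow> F \<in> X i \<Longrightarrow>
           cond_prob_given M Z F \<in> borel_measurable (sigma (space M) (X i))"
    and G: "G \<in> finite_meets X I"
  shows "cond_prob_given M Z G
    \<in> borel_measurable (sigma (space M) (join_subfields M I (\<lambda>i. X i \<inter> Z)))"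
    (is "_ \<in> borel_measurable (sigma _ ?W)")
proof -
  have W: "?W \<in> complete_subfields M"
    using X by (intro join_subfields_in_complete_subfields) (auto dest: complete_subfield_subset_sets)
  obtain J A where J: "G = (\<Inter>j\<in>J. A j)" "J \<subseteq> I" "J \<noteq> {}" "finite J" "A \<in> Pi J X"
    using G unfolding finite_meets_def by blast
  \<comment> \<open>One and the same version is measurable for \<open>X j\<close> and for
    \<open>Z\<close>, so its preimages lie in both and hence in
    \<open>X j \<inter> Z\<close>.\<close>
  have "cond_prob_given M Z (A j) \<in> borel_measurable (sigma (space M) ?W)" if j: "j \<in> J" for j
  proof (rule measurableI)
    have jI: "j \<in> I" and Aj: "A j \<in> X j"
      using j J by auto
    fix B :: "real set" assume B: "B \<in> sets borel"
    have "cond_prob_given M Z (A j) -` B \<inter> space M \<in> X j"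
      using measurable_sets[OF meas[OF jI Aj] B]
      by (simp add: space_measure_of_conv sets_sigma_complete_subfield[OF X[OF jI]])
    moreover have "cond_prob_given M Z (A j) \<in> borel_measurable (sigma (space M) Z)"
      by (simp add: cond_prob_given_def)
    from measurable_sets[OF this B] have "cond_prob_given M Z (A j) -` B \<inter> space M \<in> Z"
      by (simp add: space_measure_of_conv sets_sigma_complete_subfield[OF Z])
    moreover have "X j \<inter> Z \<subseteq> ?W"
      using jI by (rule subfield_subset_join_subfields)
    ultimately show "cond_prob_given M Z (A j) -` B \<inter> space (sigma (space M) ?W)
        \<in> sets (sigma (space M) ?W)"
      by (auto simp: space_measure_of_conv sets_sigma_complete_subfield[OF W])
  qed simp
  then have "(\<lambda>x. \<Prod>j\<in>J. cond_prob_given M Z (A j) x) \<in> borel_measurable (sigma (space M) ?W)"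
    by (rule borel_measurable_prod)
  \<comment> \<open>Conditional independence identifies the product with the chosen version only
    almost surely; completeness of \<open>?W\<close> absorbs the exceptional set.\<close>
  moreover have "AE x in M. cond_prob_given M Z G x = (\<Prod>j\<in>J. cond_prob_given M Z (A j) x)"
    using ci J by (simp add: cond_indep_sets_def)
  then have "AE x in M. (\<Prod>j\<in>J. cond_prob_given M Z (A j) x) = cond_prob_given M Z G x"
    by eventually_elim simp
  moreover have "cond_prob_given M Z G \<in> borel_measurable M"
    by (simp add: cond_prob_given_def borel_measurable_cond_exp2)
  ultimately show ?thesis
    using measurable_complete_subfield_cong_AE[OF W] by blast
qed

theorem proposition3p20:
  fixes M :: "'a measure" and X :: "'i \<Rightarrow> 'a set set" and I :: "'i set" and Z :: "'a set set"
  assumes "prob_space M"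
    and "\<And>i. i \<in> I \<Longrightarrow> X i \<in> complete_subfields M"
    and "prob_space.indep_sets M X I"
    and "Z \<in> complete_subfields M"
    and "cond_indep_sets M Z X I"
    and "\<And>i F. i \<in> I \<Longrightarrow> F \<in> X i \<Longrightarrow>
           cond_prob_given M Z F \<in> borel_measurable (sigma (space M) (X i))"
  shows "join_subfields M I X \<inter> Z = join_subfields M I (\<lambda>i. X i \<inter> Z)"
proof
  note X = assms(2) and Z = assms(4)
  define S where "S = join_subfields M I X"
  define W where "W = join_subfields M I (\<lambda>i. X i \<inter> Z)"
  have S: "S \<in> complete_subfields M"
    unfolding S_def using X by (intro join_subfields_in_complete_subfields complete_subfield_subset_sets)
  have W: "W \<in> complete_subfields M"
    unfolding W_def using X
    by (intro join_subfields_in_complete_subfields) (auto dest: complete_subfield_subset_sets)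
  have WS: "W \<subseteq> S"
    unfolding W_def using subfield_subset_join_subfields[of _ I X M]
    by (intro join_subfields_least S) (auto simp: S_def)
  have WZ: "W \<subseteq> Z"
    unfolding W_def by (intro join_subfields_least Z) auto
  show "join_subfields M I (\<lambda>i. X i \<inter> Z) \<subseteq> join_subfields M I X \<inter> Z"
    using WS WZ by (simp add: S_def W_def)
  show "join_subfields M I X \<inter> Z \<subseteq> join_subfields M I (\<lambda>i. X i \<inter> Z)"
  \<comment> \<open>For an empty family both sides reduce to the least complete subfield; the
    generator by finite intersections needs a nonempty one.\<close>
  proof (cases "I = {}")
    case True
    then show ?thesis by (simp add: join_subfields_def)
  next
    case False
    have meets: "finite_meets X I \<subseteq> sets M"
      using X by (rule finite_meets_subset_sets[OF complete_subfield_subset_sets])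
    have stable: "Int_stable (finite_meets X I)"
      using X by (intro Int_stable_finite_meets[of _ "space M"])
        (auto simp: complete_subfields_def sigma_algebra_def)
    have S_eq: "S = sigma_sets (space M) (finite_meets X I)"
      unfolding S_def using X False by (rule join_subfields_eq_sigma_sets_finite_meets)
    interpret prob_space M by fact
    interpret Z: finite_measure_subalgebra M "sigma (space M) Z"
      using \<open>prob_space M\<close> Z by (rule finite_measure_subalgebra_complete_subfield)
    interpret S: finite_measure_subalgebra M "sigma (space M) S"
      using \<open>prob_space M\<close> S by (rule finite_measure_subalgebra_complete_subfield)
    interpret W: finite_measure_subalgebra M "sigma (space M) W"
      using \<open>prob_space M\<close> W by (rule finite_measure_subalgebra_complete_subfield)
    have "F \<in> W" if FS: "F \<in> S" and FZ: "F \<in> Z" for F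
    proof -
      define u where "u = real_cond_exp M (sigma (space M) W) (indicator F)"
      define h where "h x = indicator F x - u x" for x
      have F: "F \<in> sets M"
        using FZ complete_subfield_subset_sets[OF Z] by blast
      have iF: "integrable M (indicator F :: 'a \<Rightarrow> real)"
        using F by (simp add: integrable_real_indicator emeasure_eq_measure)
      have iu: "integrable M u"
        unfolding u_def using iF by (rule W.real_cond_exp_int)
      have ih: "integrable M h"
        unfolding h_def using iF iu by (rule Bochner_Integration.integrable_diff)
      have uW: "u \<in> borel_measurable (sigma (space M) W)"
        by (simp add: u_def)
      \<comment> \<open>Used twice: with \<open>Z\<close>, to move conditioning on \<open>Z\<close>
        from \<open>h\<close> to the indicator of \<open>G\<close>, and with \<open>S\<close>, to
        recover \<open>h\<close> from its conditional expectation.\<close>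
      have hY: "h \<in> borel_measurable (sigma (space M) Y)"
        if Y: "Y \<in> complete_subfields M" "W \<subseteq> Y" "F \<in> Y" for Y
      proof -
        have "F \<in> sets (sigma (space M) Y)"
          using Y by (simp add: sets_sigma_complete_subfield)
        moreover have "u \<in> borel_measurable (sigma (space M) Y)"
          using uW W Y(1,2) by (rule measurable_sigma_mono)
        ultimately show ?thesis
          unfolding h_def by (intro borel_measurable_diff borel_measurable_indicator)
      qed
      have total: "(LINT x|M. h x) = 0"
        unfolding h_def using iF iu W.real_cond_exp_int(2)[OF iF] by (simp add: u_def)
      have "(LINT x:G|M. h x) = 0" if G: "G \<in> finite_meets X I" for G
      proof -
        define p where "p = real_cond_exp M (sigma (space M) Z) (indicator G)"
        have GM: "G \<in> sets M"
          using G meets by blast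
        have pW: "p \<in> borel_measurable (sigma (space M) W)"
          using cond_prob_finite_meet_measurable[OF X Z assms(5,6) G]
          by (simp add: p_def W_def cond_prob_given_def)
        have ihG: "integrable M (\<lambda>x. h x * indicator G x)"
          using integrable_mult_indicator[OF GM ih] by (simp add: mult.commute)
        \<comment> \<open>As \<open>h\<close> is \<open>Z\<close>-measurable, the indicator of
          \<open>G\<close> may be replaced by \<open>p\<close> under the integral against
          \<open>h\<close>.\<close>
        note hG = Z.real_cond_exp_intg[OF ihG hY[OF Z WZ FZ] borel_measurable_indicator[OF GM]]
        have ip: "integrable M p"
          unfolding p_def using GM
          by (intro Z.real_cond_exp_int) (simp add: integrable_real_indicator emeasure_eq_measure)
        have ipF: "integrable M (\<lambda>x. p x * indicator F x)"
          using integrable_mult_indicator[OF F ip] by (simp add: mult.commute)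
        \<comment> \<open>As \<open>p\<close> is \<open>W\<close>-measurable, the indicator of
          \<open>F\<close> and \<open>u\<close> have the same integral against \<open>p\<close>;
          their difference is \<open>h\<close>.\<close>
        note pF = W.real_cond_exp_intg[OF ipF pW borel_measurable_indicator[OF F]]
        have "(LINT x:G|M. h x) = (LINT x|M. h x * p x)"
          using hG(2) by (simp add: set_lebesgue_integral_def p_def mult.commute)
        also have "\<dots> = (LINT x|M. p x * indicator F x - p x * u x)"
          by (simp add: h_def algebra_simps)
        also have "\<dots> = 0"
          using ipF pF by (simp add: u_def)
        finally show ?thesis .
      qed
      then have "(LINT x:A|M. h x) = 0" if "A \<in> S" for A
        using set_integral_eq_zero_on_sigma_sets[OF ih meets stable total] that
        by (simp add: S_eq)
      \<comment> \<open>Both the zero function and \<open>h\<close> itself are versions of the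
        conditional expectation of \<open>h\<close> given \<open>S\<close>.\<close>
      then have "AE x in M. real_cond_exp M (sigma (space M) S) h x = 0"
        using ih by (intro S.real_cond_exp_charact)
          (auto simp: sets_sigma_complete_subfield[OF S] set_lebesgue_integral_def)
      moreover have "AE x in M. real_cond_exp M (sigma (space M) S) h x = h x"
        using ih hY[OF S WS FS] by (rule S.real_cond_exp_F_meas)
      ultimately have "AE x in M. u x = indicator F x"
        by eventually_elim (simp add: h_def)
      with W uW borel_measurable_indicator[OF F]
      have "(indicator F :: 'a \<Rightarrow> real) \<in> borel_measurable (sigma (space M) W)"
        by (rule measurable_complete_subfield_cong_AE)
      then have "F \<inter> space M \<in> W"
        by (simp add: borel_measurable_indicator_iff space_measure_of_conv
            sets_sigma_complete_subfield[OF W])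
      then show ?thesis
        using sets.sets_into_space[OF F] by (simp add: Int_absorb2)
    qed
    then show ?thesis
      by (auto simp: S_def W_def)
  qed
qed

end
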